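(* Let $n\in\mathbb{N}$, let $\rho>0$, let $f:\mathbb{R}^n\to\mathbb{R}$ be continuous, and let $X\subseteq\mathbb{R}^n$. For $x^*\in\mathbb{R}^n$ the following statements are equivalent: (i) $x^*$ is a local minimum of (SPO). (ii) There exists $y^*\in\mathbb{R}^n$ such that $(x^*,y^* )$ is a local minimum of (SPOlin). (iii) There exists $y^*\in\mathbb{R}^n$ such that $(x^*,y^* )$ is a local minimum of (SPOsq). (All three problems are taken with the same $\rho$, $f$ and $X$ and are defined in the context.)
   Context: For $x\in\mathbb{R}^n$, $\|x\|_0$ is the number of nonzero components of $x$; $e=(1,\dots,1)^T\in\mathbb{R}^n$; $x\circ y$ is the componentwise product; inequalities between vectors are componentwise. The problems are: (SPO): $\min_{x} f(x)+\rho\|x\|_0$ subject to $x\in X$. (SPOlin): $\min_{(x,y)} f(x)+\rho(n-e^Ty)$ subject to $x\in X$, $x\circ y=0$, $y\le e$, with $(x,y)\in\mathbb{R}^n\times\mathbb{R}^n$. (SPOsq): $\min_{(x,y)} f(x)+\frac{\rho}{2}\sum_{i=1}^n y_i(y_i-2)$ subject to $x\in X$, $x\circ y=0$, with $(x,y)\in\mathbb{R}^n\times\mathbb{R}^n$. A local minimum is a feasible point minimizing the objective among all feasible points in some neighbourhood. *)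

theory Defs
  imports "HOL-Analysis.Analysis"
begin

text \<open>
  The space \<open>R^n\<close> is \<^typ>\<open>real ^ 'n\<close> with \<open>n = CARD('n)\<close>.  The library's \<open>*\<close>, \<open>0\<close>, \<open>1\<close> and \<open>\<le>\<close>
  on this type are componentwise: \<open>x * y\<close> is the Hadamard product and \<open>1\<close> is the
  all-ones vector \<open>e\<close>.
\<close>

definition l0_norm :: "real ^ 'n \<Rightarrow> nat" where
  "l0_norm x = card {i. x $ i \<noteq> 0}"

definition local_minimum :: "('a::topological_space \<Rightarrow> real) \<Rightarrow> 'a set \<Rightarrow> 'a \<Rightarrow> bool" where
  "local_minimum F S z \<longleftrightarrow>
     z \<in> S \<and> (\<exists>U. open U \<and> z \<in> U \<and> (\<forall>w \<in> S \<inter> U. F z \<le> F w))"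

text \<open>The feasible set of (SPO) is \<open>X\<close> itself.\<close>

definition SPO_objective :: "real \<Rightarrow> (real ^ 'n \<Rightarrow> real) \<Rightarrow> real ^ 'n \<Rightarrow> real" where
  "SPO_objective \<rho> f x = f x + \<rho> * real (l0_norm x)"

definition SPOlin_feasible :: "(real ^ 'n) set \<Rightarrow> ((real ^ 'n) \<times> (real ^ 'n)) set" where
  "SPOlin_feasible X = {(x, y). x \<in> X \<and> x * y = 0 \<and> y \<le> 1}"

definition SPOlin_objective ::
    "real \<Rightarrow> (real ^ 'n \<Rightarrow> real) \<Rightarrow> (real ^ 'n) \<times> (real ^ 'n) \<Rightarrow> real" where
  "SPOlin_objective \<rho> f = (\<lambda>(x, y). f x + \<rho> * (real CARD('n) - 1 \<bullet> y))"

definition SPOsq_feasible :: "(real ^ 'n) set \<Rightarrow> ((real ^ 'n) \<times> (real ^ 'n)) set" where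
  "SPOsq_feasible X = {(x, y). x \<in> X \<and> x * y = 0}"

definition SPOsq_objective ::
    "real \<Rightarrow> (real ^ 'n \<Rightarrow> real) \<Rightarrow> (real ^ 'n) \<times> (real ^ 'n) \<Rightarrow> real" where
  "SPOsq_objective \<rho> f = (\<lambda>(x, y). f x + \<rho> / 2 * (\<Sum>i\<in>UNIV. y $ i * (y $ i - 2)))"

end

theory Submission
  imports Defs
begin

text \<open>
  All three problems have the same local solutions because each of them is locally equivalent to
  minimizing \<open>f\<close> alone over the points of \<open>X\<close> that vanish wherever \<open>x\<^sup>*\<close> does
  (the restricted problem below).

  For (SPO), a point near \<open>x\<^sup>*\<close> keeps the nonzero components of \<open>x\<^sup>*\<close>. Either it has
  the same support, and then the \<open>l0\<close> terms agree, or it has at least one more nonzero component;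
  then the penalty grows by at least \<open>\<rho>\<close>, which by continuity of \<open>f\<close> outweighs any decrease
  of \<open>f\<close> near \<open>x\<^sup>*\<close>. This is \<open>local_minimum_SPO_iff\<close>.

  The two lifted problems both have an objective \<open>f x + (\<Sum>i. \<psi> (y $ i))\<close>, a constraint
  \<open>x * y = 0\<close> and bounds \<open>y $ i \<in> T\<close>, where \<open>\<psi>\<close> is minimal on \<open>T\<close> at \<open>a = 1\<close>.
  From a local minimum of \<open>f\<close> on the restricted set, the vector \<open>y\<^sup>*\<close> that equals \<open>a\<close> on the
  zeros of \<open>x\<^sup>*\<close> and \<open>0\<close> elsewhere gives a local minimum: since \<open>a \<noteq> 0\<close>, nearby
  feasible pairs have \<open>x\<close> in the restricted set, and their terms \<open>\<psi> (y $ i)\<close> are no smaller.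
  Conversely, fixing \<open>y = y\<^sup>*\<close> keeps every point
  of the restricted set feasible. This is \<open>ex_local_minimum_lifted_iff\<close>. No relation between the
  sizes of the penalties is used, so the factor \<open>\<rho> / 2\<close> in (SPOsq) is harmless.
\<close>

lemma local_minimum_iff_eventually:
  "local_minimum F S z \<longleftrightarrow> z \<in> S \<and> (\<forall>\<^sub>F w in nhds z. w \<in> S \<longrightarrow> F z \<le> F w)"
  unfolding local_minimum_def eventually_nhds by blast

text \<open>The points of \<open>X\<close> whose support is contained in the support of \<open>x\<close>.\<close>

definition zeros_restricted :: "(real ^ 'n) set \<Rightarrow> real ^ 'n \<Rightarrow> (real ^ 'n) set" where
  "zeros_restricted X x = {z \<in> X. \<forall>i. x $ i = 0 \<longrightarrow> z $ i = 0}"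

lemma eventually_vec_nth_neq:
  fixes x c :: "real ^ 'n"
  shows "\<forall>\<^sub>F z in nhds x. \<forall>i. x $ i \<noteq> c $ i \<longrightarrow> z $ i \<noteq> c $ i"
proof (rule eventually_all_finite)
  fix i
  have "((\<lambda>z. z $ i) \<longlongrightarrow> x $ i) (nhds x)"
    by (intro tendsto_vec_nth filterlim_ident)
  then show "\<forall>\<^sub>F z in nhds x. x $ i \<noteq> c $ i \<longrightarrow> z $ i \<noteq> c $ i"
    using tendsto_imp_eventually_ne[of "\<lambda>z. z $ i" "x $ i" "nhds x" "c $ i"]
    by (cases "x $ i = c $ i") auto
qed

lemma local_minimum_SPO_iff:
  fixes f :: "real ^ 'n \<Rightarrow> real"
  assumes "\<rho> > 0" and "isCont f x"
  shows "local_minimum (SPO_objective \<rho> f) X x \<longleftrightarrow> local_minimum f (zeros_restricted X x) x"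
proof
  assume L: "local_minimum (SPO_objective \<rho> f) X x"
  have "f x \<le> f z" if z: "z \<in> zeros_restricted X x"
    and le: "z \<in> X \<longrightarrow> SPO_objective \<rho> f x \<le> SPO_objective \<rho> f z" for z
  proof -
    have "l0_norm z \<le> l0_norm x"
      unfolding l0_norm_def using z by (intro card_mono) (auto simp: zeros_restricted_def)
    then have "\<rho> * real (l0_norm z) \<le> \<rho> * real (l0_norm x)"
      using \<open>\<rho> > 0\<close> by simp
    then show ?thesis
      using z le by (auto simp: zeros_restricted_def SPO_objective_def)
  qed
  then show "local_minimum f (zeros_restricted X x) x"
    using L unfolding local_minimum_iff_eventually
    by (auto simp: zeros_restricted_def elim: eventually_mono)
next
  assume L: "local_minimum f (zeros_restricted X x) x"
  then have ev: "\<forall>\<^sub>F z in nhds x. z \<in> zeros_restricted X x \<longrightarrow> f x \<le> f z"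
    by (simp add: local_minimum_iff_eventually)
  have close: "\<forall>\<^sub>F z in nhds x. f x - \<rho> < f z"
    using \<open>isCont f x\<close> \<open>\<rho> > 0\<close>
    by (intro order_tendstoD(1)[of f "f x"]) (auto simp: isCont_def tendsto_at_iff_tendsto_nhds)
  have "\<forall>\<^sub>F z in nhds x. z \<in> X \<longrightarrow> SPO_objective \<rho> f x \<le> SPO_objective \<rho> f z"
    using ev close eventually_vec_nth_neq[of x 0]
  proof eventually_elim
    case (elim z)
    have sub: "{i. x $ i \<noteq> 0} \<subseteq> {i. z $ i \<noteq> 0}"
      using elim(3) by auto
    show ?case
    proof (cases "{i. x $ i \<noteq> 0} = {i. z $ i \<noteq> 0}")
      case True
      then have "z \<in> zeros_restricted X x" if "z \<in> X"
        using that by (auto simp: zeros_restricted_def)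
      with elim(1) True show ?thesis
        by (simp add: SPO_objective_def l0_norm_def)
    next
      case False
      with sub have "l0_norm x < l0_norm z"
        unfolding l0_norm_def by (intro psubset_card_mono) auto
      then have "real (l0_norm x) + 1 \<le> real (l0_norm z)"
        by simp
      then have "\<rho> * (real (l0_norm x) + 1) \<le> \<rho> * real (l0_norm z)"
        using \<open>\<rho> > 0\<close> by (intro mult_left_mono) auto
      with elim(2) show ?thesis
        by (simp add: SPO_objective_def distrib_left)
    qed
  qed
  with L show "local_minimum (SPO_objective \<rho> f) X x"
    by (auto simp: local_minimum_iff_eventually zeros_restricted_def)
qed

text \<open>
  The hypotheses on \<open>T\<close>, \<open>a\<close> and \<open>\<psi>\<close> are needed only to find a \<open>y\<close> for a given local
  minimum \<open>x\<close> of the restricted problem. Requiring \<open>a \<noteq> 0\<close> makes the zero pattern of \<open>x\<close>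
  persist near \<open>(x, y)\<close>, so no continuity is involved.
\<close>

lemma ex_local_minimum_lifted_iff:
  fixes f :: "real ^ 'n \<Rightarrow> real" and \<psi> :: "real \<Rightarrow> real"
  assumes "0 \<in> T" and "a \<in> T" and "a \<noteq> 0"
    and min: "\<And>t. t \<in> T \<Longrightarrow> \<psi> a \<le> \<psi> t"
  shows "(\<exists>y. local_minimum (\<lambda>(x, y). f x + (\<Sum>i\<in>UNIV. \<psi> (y $ i)))
              {(x, y). x \<in> X \<and> x * y = 0 \<and> (\<forall>i. y $ i \<in> T)} (x, y))
    \<longleftrightarrow> local_minimum f (zeros_restricted X x) x"
    (is "(\<exists>y. local_minimum ?F ?S (x, y)) \<longleftrightarrow> _")
proof
  assume "\<exists>y. local_minimum ?F ?S (x, y)"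
  then obtain y where feas: "(x, y) \<in> ?S"
    and ev: "\<forall>\<^sub>F w in nhds (x, y). w \<in> ?S \<longrightarrow> ?F (x, y) \<le> ?F w"
    by (auto simp: local_minimum_iff_eventually)
  have "filterlim (\<lambda>z. (z, y)) (nhds (x, y)) (nhds x)"
    by (intro tendsto_Pair filterlim_ident tendsto_const)
  from eventually_compose_filterlim[OF ev this]
  have "\<forall>\<^sub>F z in nhds x. (z, y) \<in> ?S \<longrightarrow> f x \<le> f z"
    by simp
  moreover have "(z, y) \<in> ?S" if "z \<in> zeros_restricted X x" for z
    using that feas by (auto simp: zeros_restricted_def vec_eq_iff)
  ultimately show "local_minimum f (zeros_restricted X x) x"
    using feas unfolding local_minimum_iff_eventually
    by (auto simp: zeros_restricted_def elim: eventually_mono)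
next
  assume L: "local_minimum f (zeros_restricted X x) x"
  define y :: "real ^ 'n" where "y = (\<chi> i. if x $ i = 0 then a else 0)"
  have fst: "filterlim fst (nhds x) (nhds (x, y))" and snd: "filterlim snd (nhds y) (nhds (x, y))"
    using tendsto_fst[OF filterlim_ident, of "(x, y)"] tendsto_snd[OF filterlim_ident, of "(x, y)"]
    by simp_all
  from L have "\<forall>\<^sub>F z in nhds x. z \<in> zeros_restricted X x \<longrightarrow> f x \<le> f z"
    by (simp add: local_minimum_iff_eventually)
  note ev = eventually_compose_filterlim[OF this fst]
    eventually_compose_filterlim[OF eventually_vec_nth_neq[of x 0] fst]
    eventually_compose_filterlim[OF eventually_vec_nth_neq[of y 0] snd]
  have "\<forall>\<^sub>F w in nhds (x, y). w \<in> ?S \<longrightarrow> ?F (x, y) \<le> ?F w"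
    using ev
  proof eventually_elim
    case (elim w)
    obtain z v where w: "w = (z, v)" by force
    show ?case
    proof
      assume "w \<in> ?S"
      then have z: "z \<in> X" and compl: "\<And>i. z $ i = 0 \<or> v $ i = 0" and v: "\<And>i. v $ i \<in> T"
        by (auto simp: w vec_eq_iff)
      \<comment> \<open>On the zeros of \<open>x\<close> the component of \<open>v\<close> is close to \<open>a \<noteq> 0\<close>, which forces
        that of \<open>z\<close> to vanish.\<close>
      have "z $ i = 0" if "x $ i = 0" for i
        using elim(3) compl[of i] that \<open>a \<noteq> 0\<close> by (auto simp: w y_def)
      with z elim(1) have "f x \<le> f z"
        by (auto simp: w zeros_restricted_def)
      moreover have "\<psi> (y $ i) \<le> \<psi> (v $ i)" for i
        using elim(2) compl[of i] min[OF v[of i]] by (auto simp: w y_def)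
      then have "(\<Sum>i\<in>UNIV. \<psi> (y $ i)) \<le> (\<Sum>i\<in>UNIV. \<psi> (v $ i))"
        by (intro sum_mono)
      ultimately show "?F (x, y) \<le> ?F w"
        by (simp add: w)
    qed
  qed
  moreover have "(x, y) \<in> ?S"
    using L \<open>0 \<in> T\<close> \<open>a \<in> T\<close>
    by (auto simp: local_minimum_iff_eventually zeros_restricted_def vec_eq_iff y_def)
  ultimately show "\<exists>y. local_minimum ?F ?S (x, y)"
    unfolding local_minimum_iff_eventually by blast
qed

lemma SPOlin_objective_eq_sum:
  fixes f :: "real ^ 'n \<Rightarrow> real"
  shows "SPOlin_objective \<rho> f = (\<lambda>(x, y). f x + (\<Sum>i\<in>UNIV. \<rho> * (1 - y $ i)))"
  by (auto simp: SPOlin_objective_def inner_vec_def sum_subtractf simp flip: sum_distrib_left)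

lemma SPOlin_feasible_eq:
  "SPOlin_feasible X = {(x, y). x \<in> X \<and> x * y = 0 \<and> (\<forall>i. y $ i \<in> {..1})}"
  by (auto simp: SPOlin_feasible_def less_eq_vec_def)

lemma SPOsq_objective_eq_sum:
  "SPOsq_objective \<rho> f = (\<lambda>(x, y). f x + (\<Sum>i\<in>UNIV. \<rho> / 2 * (y $ i * (y $ i - 2))))"
  by (simp only: SPOsq_objective_def sum_distrib_left)

lemma SPOsq_feasible_eq:
  "SPOsq_feasible X = {(x, y). x \<in> X \<and> x * y = 0 \<and> (\<forall>i. y $ i \<in> UNIV)}"
  by (simp add: SPOsq_feasible_def)

theorem theorem3p4:
  fixes \<rho> :: real
    and f :: "real ^ 'n \<Rightarrow> real"
    and X :: "(real ^ 'n) set"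
    and xs :: "real ^ 'n"
  assumes "\<rho> > 0"
    and "continuous_on UNIV f"
  shows "(local_minimum (SPO_objective \<rho> f) X xs
            \<longleftrightarrow> (\<exists>ys. local_minimum (SPOlin_objective \<rho> f) (SPOlin_feasible X) (xs, ys)))
       \<and> (local_minimum (SPO_objective \<rho> f) X xs
            \<longleftrightarrow> (\<exists>ys. local_minimum (SPOsq_objective \<rho> f) (SPOsq_feasible X) (xs, ys)))"
proof -
  have "isCont f xs"
    using assms(2) by (simp add: continuous_on_eq_continuous_at)
  note SPO = local_minimum_SPO_iff[OF \<open>\<rho> > 0\<close> this, of X]
  have lin: "(\<exists>ys. local_minimum (SPOlin_objective \<rho> f) (SPOlin_feasible X) (xs, ys))
      \<longleftrightarrow> local_minimum f (zeros_restricted X xs) xs"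
    unfolding SPOlin_objective_eq_sum SPOlin_feasible_eq
    by (rule ex_local_minimum_lifted_iff[where a = 1]) (use \<open>\<rho> > 0\<close> in auto)
  have min: "\<rho> / 2 * (1 * (1 - 2)) \<le> \<rho> / 2 * (t * (t - 2))" for t :: real
  proof (intro mult_left_mono)
    have "0 \<le> (t - 1)\<^sup>2" by simp
    then show "1 * (1 - 2) \<le> t * (t - 2)"
      by (simp add: power2_eq_square algebra_simps)
  qed (use \<open>\<rho> > 0\<close> in simp)
  have sq: "(\<exists>ys. local_minimum (SPOsq_objective \<rho> f) (SPOsq_feasible X) (xs, ys))
      \<longleftrightarrow> local_minimum f (zeros_restricted X xs) xs"
    unfolding SPOsq_objective_eq_sum SPOsq_feasible_eq
    by (rule ex_local_minimum_lifted_iff[where a = 1]) (use min in auto)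
  from SPO lin sq show ?thesis by simp
qed

end
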